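(* For $a=1,2,3$, let $\mathcal{N}_a$ be the set of partitions defined in the context. The series $f_{\mathcal{N}_a}(x,q)=\sum_{\lambda\in\mathcal{N}_a}x^{\ell(\lambda)}q^{|\lambda|}$ satisfies the $q$-difference equation $$0=\sum_{i=0}^{5}p^{(a)}_{2i}(x,q)\,f_{\mathcal{N}_a}(xq^{2i},q),$$ where $p^{(a)}_{2i}=p^{(a)}_{2i}(x,q)$ are as follows. For $a=1$: $p^{(1)}_0=1$; $p^{(1)}_2=-1-x(q^2+q^3+q^4)$; $p^{(1)}_4=xq^4(1-x+xq^3+xq^4+xq^5)$; $p^{(1)}_6=x^2q^6(-1+xq^4(1+q+q^2-q^5))$; $p^{(1)}_8=x^3q^{13}(1+q+q^2)(1-xq^6)$; $p^{(1)}_{10}=x^3q^{17}(1-xq^6)(1-xq^8)$. For $a=2$: $p^{(2)}_0=1$; $p^{(2)}_2=-1-x(q+q^2+q^4)$; $p^{(2)}_4=xq^4(1+xq+xq^3)$; $p^{(2)}_6=x^2q^{10}(-1+xq^4+xq^6)$; $p^{(2)}_8=x^3q^{15}(1+q^2+q^3)(1-xq^6)$; $p^{(2)}_{10}=x^3q^{19}(1-xq^6)(1-xq^8)$. For $a=3$: $p^{(3)}_0=1$; $p^{(3)}_2=-1-x(q^2+q^4+q^5)$; $p^{(3)}_4=xq^4(1+xq^5+xq^7)$; $p^{(3)}_6=x^2q^{10}(-1+xq^4+xq^6)$; $p^{(3)}_8=x^3q^{18}(1+q+q^3)(1-xq^6)$; $p^{(3)}_{10}=x^3q^{23}(1-x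q^6)(1-xq^8)$.
   Context: A partition is a finite weakly decreasing sequence $\lambda=(\lambda_1,\dots,\lambda_\ell)$ of positive integers (possibly empty); $\ell(\lambda)=\ell$ is its length, $|\lambda|=\sum_i\lambda_i$, and $m_i(\lambda)=\#\{j\mid\lambda_j=i\}$. A finite sequence $(i_1,\dots,i_N)$ matches a nonempty finite sequence $(j_1,\dots,j_n)$ if $(i_{k+1},\dots,i_{k+n})=(j_1,\dots,j_n)$ for some $0\le k\le N-n$. $\mathcal{N}$ is the set of partitions $\lambda$ satisfying all of the following: (N1) for all $1\le i\le\ell(\lambda)-1$, $\lambda_i-\lambda_{i+1}\ne1$; (N2) for all $1\le i\le\ell(\lambda)-2$, $\lambda_i-\lambda_{i+2}\ge3$; (N3) for all $1\le i\le\ell(\lambda)-2$, $\lambda_i-\lambda_{i+2}=3\Rightarrow\lambda_i\ne\lambda_{i+1}$; (N4) for all $1\le i\le\ell(\lambda)-2$, ($\lambda_i-\lambda_{i+2}=3$ and $\lambda_i$ odd) $\Rightarrow\lambda_{i+1}\ne\lambda_{i+2}$; (N5) for all $1\le i\le\ell(\lambda)-2$, ($\lambda_i-\lambda_{i+2}=4$ and $\lambda_i$ odd) $\Rightarrow$ ($\lambda_i\ne\lambda_{i+1}$ and $\lambda_{i+1}\ne\lambda_{i+2}$); (N6) the sequence $(\lambda_1-\lambda_2,\lambda_2-\lambda_3,\dots,\lambda_{\ell(\lambda)-1}-\lambda_{\ell(\lambda)})$ does not match $(3,2^*,3,0)$, where $2^*$ denotes any number (possibly zero) of repetitions of $2$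 (i.e. it matches none of the sequences $(3,2,\dots,2,3,0)$ with $k\ge0$ copies of $2$). Then $\mathcal{N}_1=\{\lambda\in\mathcal{N}\mid m_1(\lambda)=0\}$; $\mathcal{N}_2=\{\lambda\in\mathcal{N}\mid m_i(\lambda)\le1\text{ for }i=1,2,3\}$; $\mathcal{N}_3$ is the set of $\lambda\in\mathcal{N}$ with $m_1(\lambda)=m_3(\lambda)=0$, $m_2(\lambda)\le1$, and such that $\lambda$ does not match $(2k+3,2k,2k-2,\dots,4,2)$ for any $k\ge1$. *)

theory Defs
  imports
    "HOL-Library.Sublist"
    "HOL-Computational_Algebra.Formal_Power_Series"
begin

definition is_partition :: "nat list \<Rightarrow> bool" where
  "is_partition xs \<longleftrightarrow> sorted_wrt (\<ge>) xs \<and> (\<forall>x\<in>set xs. x > 0)"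

text \<open>
  The part \<open>\<lambda>\<^sub>i\<close> is \<open>xs ! (i - 1)\<close>. Natural-number subtraction is exact
  wherever it is applied below, since it is only used on entries \<open>xs ! i\<close> and \<open>xs ! j\<close>
  with \<open>i \<le> j\<close> of a weakly decreasing list. Matching (occurrence as a contiguous block)
  is the library's \<^const>\<open>sublist\<close>.
\<close>

definition diffs :: "nat list \<Rightarrow> nat list" where
  "diffs xs = map (\<lambda>i. xs ! i - xs ! (i + 1)) [0..<length xs - 1]"

definition setN :: "nat list set" where
  "setN = {xs. is_partition xs \<and>
     (\<forall>i. i + 1 < length xs \<longrightarrow> xs ! i - xs ! (i + 1) \<noteq> 1) \<and>
     (\<forall>i. i + 2 < length xs \<longrightarrow> xs ! i - xs ! (i + 2) \<ge> 3) \<and>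
     (\<forall>i. i + 2 < length xs \<longrightarrow>
        xs ! i - xs ! (i + 2) = 3 \<longrightarrow> xs ! i \<noteq> xs ! (i + 1)) \<and>
     (\<forall>i. i + 2 < length xs \<longrightarrow>
        xs ! i - xs ! (i + 2) = 3 \<and> odd (xs ! i) \<longrightarrow> xs ! (i + 1) \<noteq> xs ! (i + 2)) \<and>
     (\<forall>i. i + 2 < length xs \<longrightarrow>
        xs ! i - xs ! (i + 2) = 4 \<and> odd (xs ! i) \<longrightarrow>
        xs ! i \<noteq> xs ! (i + 1) \<and> xs ! (i + 1) \<noteq> xs ! (i + 2)) \<and>
     (\<forall>k. \<not> sublist ([3] @ replicate k 2 @ [3, 0]) (diffs xs))}"

definition setN1 :: "nat list set" where
  "setN1 = {xs \<in> setN. count_list xs 1 = 0}"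

definition setN2 :: "nat list set" where
  "setN2 = {xs \<in> setN. \<forall>i\<in>{1, 2, 3}. count_list xs i \<le> 1}"

definition setN3 :: "nat list set" where
  "setN3 = {xs \<in> setN. count_list xs 1 = 0 \<and> count_list xs 3 = 0 \<and> count_list xs 2 \<le> 1 \<and>
     (\<forall>k\<ge>1. \<not> sublist ((2 * k + 3) # map (\<lambda>j. 2 * j) (rev [1..<k + 1])) xs)}"

text \<open>
  Formal power series in \<open>x\<close> and \<open>q\<close> are power series in \<open>x\<close> (outer
  variable) whose coefficients are power series in \<open>q\<close> (inner variable).
\<close>

type_synonym series = "int fps fps"

definition varx :: series where "varx = fps_X"

definition varq :: series where "varq = fps_const fps_X"

definition gen_series :: "nat list set \<Rightarrow> series" where
  "gen_series A =
     Abs_fps (\<lambda>l. Abs_fps (\<lambda>n. int (card {xs \<in> A. length xs = l \<and> sum_list xs = n})))"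

text \<open>The cardinalities above are those of finite sets when \<open>A\<close> consists of partitions.\<close>

lemma finite_partitions_of: "finite {xs. is_partition xs \<and> length xs = l \<and> sum_list xs = n}"
proof (rule finite_subset)
  show "{xs. is_partition xs \<and> length xs = l \<and> sum_list xs = n}
          \<subseteq> {xs. set xs \<subseteq> {..n} \<and> length xs = l}"
    using member_le_sum_list by fastforce
  show "finite {xs. set xs \<subseteq> {..n} \<and> length xs = l}"
    by (rule finite_lists_length_eq) simp
qed

text \<open>The substitution \<open>f(x q\<^sup>m, q)\<close>.\<close>

definition qshift :: "nat \<Rightarrow> series \<Rightarrow> series" where
  "qshift m f = fps_compose f (varx * varq ^ m)"

text \<open>Entry \<open>i\<close> of each list, counted from 0, is the coefficient \<open>p\<^sub>2\<^sub>i\<close>.\<close>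

definition coeffs1 :: "'a::comm_ring_1 \<Rightarrow> 'a \<Rightarrow> 'a list" where
  "coeffs1 x q =
    [1,
     - 1 - x * (q^2 + q^3 + q^4),
     x * q^4 * (1 - x + x * q^3 + x * q^4 + x * q^5),
     x^2 * q^6 * (- 1 + x * q^4 * (1 + q + q^2 - q^5)),
     x^3 * q^13 * (1 + q + q^2) * (1 - x * q^6),
     x^3 * q^17 * (1 - x * q^6) * (1 - x * q^8)]"

definition coeffs2 :: "'a::comm_ring_1 \<Rightarrow> 'a \<Rightarrow> 'a list" where
  "coeffs2 x q =
    [1,
     - 1 - x * (q + q^2 + q^4),
     x * q^4 * (1 + x * q + x * q^3),
     x^2 * q^10 * (- 1 + x * q^4 + x * q^6),
     x^3 * q^15 * (1 + q^2 + q^3) * (1 - x * q^6),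
     x^3 * q^19 * (1 - x * q^6) * (1 - x * q^8)]"

definition coeffs3 :: "'a::comm_ring_1 \<Rightarrow> 'a \<Rightarrow> 'a list" where
  "coeffs3 x q =
    [1,
     - 1 - x * (q^2 + q^4 + q^5),
     x * q^4 * (1 + x * q^5 + x * q^7),
     x^2 * q^10 * (- 1 + x * q^4 + x * q^6),
     x^3 * q^18 * (1 + q + q^3) * (1 - x * q^6),
     x^3 * q^23 * (1 - x * q^6) * (1 - x * q^8)]"

end

theory Submission
  imports Defs
begin

text \<open>
  The conditions defining \<^const>\<open>setN\<close> are local and invariant under adding 2 to every part, so they are
  recognised by a finite automaton that reads the parts in increasing order, with states taken
  modulo translation by 2. Removing the parts equal to 1 and 2 and subtracting 2 from the others
  turns this into a linear system for the series of the states, relating their values at \<open>x\<close> and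
  \<open>x q\<^sup>2\<close>; each of the three sets is the language of one state. Eliminating the other unknowns
  gives the three equations of order five.
\<close>

text \<open>The translation step is 2 because (N4) and (N5) test parity. Only (N6) has unbounded
  reach, and one flag suffices to remember it. Each translation lowers \<open>v\<close> by 2; the
  system still closes up, because from \<open>v \<le> -4\<close> every positive part is at distance
  at least 5, where nothing is forbidden. The series equations split off the smallest part, whereas
  membership in \<open>setN\<close> is compared with the automaton by prepending a largest part; for
  this the flag reached by a run has to be read off from the list itself.\<close>

unbundle fps_syntax

section \<open>Generating series\<close>

lemma varq_power: "varq ^ m = fps_const (fps_X ^ m)"
  by (simp add: varq_def fps_const_power)

lemma qshift_nth: "qshift m f $ l = fps_X ^ (m * l) * f $ l"
proof -
  have "varx * varq ^ m = fps_const (fps_X ^ m) * fps_X"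
    by (simp add: varx_def varq_power mult.commute)
  then show ?thesis
    by (simp add: qshift_def fps_compose_linear power_mult)
qed

lemma gen_series_nth:
  "gen_series A $ l $ n = int (card {xs \<in> A. length xs = l \<and> sum_list xs = n})"
  by (simp add: gen_series_def)

lemma qshift_add: "qshift m (f + g) = qshift m f + qshift m g"
  by (rule fps_ext) (simp add: qshift_nth algebra_simps)

lemma qshift_mult: "qshift m (f * g) = qshift m f * qshift m g"
  by (simp add: qshift_def fps_compose_mult_distrib varx_def)

lemma qshift_varx: "qshift m varx = varx * varq ^ m"
  by (simp add: qshift_def varx_def)

lemma qshift_varq_power: "qshift m (varq ^ k) = varq ^ k"
  by (simp add: qshift_def varq_power)

lemma qshift_qshift: "qshift m (qshift k f) = qshift (m + k) f"
  by (rule fps_ext) (simp add: qshift_nth algebra_simps power_add)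

lemma qshift_0: "qshift 0 f = f"
  by (rule fps_ext) (simp add: qshift_nth)

lemma gen_series_Un:
  assumes "A \<inter> B = {}" "A \<subseteq> Collect is_partition" "B \<subseteq> Collect is_partition"
  shows "gen_series (A \<union> B) = gen_series A + gen_series B"
proof (intro fps_ext)
  fix l n
  let ?P = "\<lambda>C :: nat list set. {xs \<in> C. length xs = l \<and> sum_list xs = n}"
  have "finite (?P C)" if "C \<subseteq> Collect is_partition" for C
    by (rule finite_subset[OF _ finite_partitions_of[of l n]]) (use that in auto)
  moreover have "?P (A \<union> B) = ?P A \<union> ?P B" by auto
  ultimately show "gen_series (A \<union> B) $ l $ n = (gen_series A + gen_series B) $ l $ n"
    using assms by (simp add: gen_series_nth) (subst card_Un_disjoint, auto)
qed

lemma gen_series_empty: "gen_series {} = 0"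
  by (intro fps_ext) (simp add: gen_series_nth)

lemma gen_series_snoc: "gen_series ((\<lambda>xs. xs @ [w]) ` A) = varx * varq ^ w * gen_series A"
proof (intro fps_ext)
  fix l n
  let ?P = "\<lambda>C l n. {xs \<in> C. length xs = l \<and> sum_list xs = n}"
  let ?B = "(\<lambda>xs. xs @ [w]) ` A"
  have E: "varx * varq ^ w * gen_series A = fps_X * (fps_const (fps_X ^ w) * gen_series A)"
    by (simp only: varx_def varq_power mult.assoc)
  have R: "(varx * varq ^ w * gen_series A) $ l $ n =
      (if l = 0 \<or> n < w then 0 else int (card (?P A (l - 1) (n - w))))"
    unfolding E by (simp add: gen_series_nth fps_X_power_mult_nth)
  show "gen_series ?B $ l $ n = (varx * varq ^ w * gen_series A) $ l $ n"
  proof (cases "l = 0 \<or> n < w")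
    case True
    then have "?P ?B l n = {}" by auto
    then show ?thesis using True by (simp add: R gen_series_nth del: Collect_empty_eq)
  next
    case False
    then have "?P ?B l n = (\<lambda>xs. xs @ [w]) ` ?P A (l - 1) (n - w)" by auto
    then have "card (?P ?B l n) = card (?P A (l - 1) (n - w))"
      by (simp add: card_image inj_on_def)
    then show ?thesis using False by (simp add: R gen_series_nth)
  qed
qed

lemma sum_list_map_add: "sum_list (map (\<lambda>x. x + m) xs) = sum_list xs + m * length xs" for m :: nat
  by (induction xs) auto

text \<open>With \<open>l\<close> parts the weight grows by \<open>m * l\<close>, which is exactly
  how \<open>x q^m\<close> rescales the coefficient of \<open>x^l\<close>.\<close>

lemma gen_series_map_add: "gen_series (map (\<lambda>x. x + m) ` A) = qshift m (gen_series A)"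
proof (intro fps_ext)
  fix l n
  let ?P = "\<lambda>C n. {xs \<in> C. length xs = l \<and> sum_list xs = n}"
  let ?B = "map (\<lambda>x. x + m) ` A"
  have R: "qshift m (gen_series A) $ l $ n = (if n < m * l then 0 else int (card (?P A (n - m * l))))"
    by (simp add: qshift_nth gen_series_nth fps_X_power_mult_nth)
  show "gen_series ?B $ l $ n = qshift m (gen_series A) $ l $ n"
  proof (cases "n < m * l")
    case True
    then have "?P ?B n = {}" by (auto simp: sum_list_map_add)
    then show ?thesis using True by (simp add: R gen_series_nth del: Collect_empty_eq)
  next
    case False
    then have "?P ?B n = map (\<lambda>x. x + m) ` ?P A (n - m * l)"
      by (auto simp: sum_list_map_add image_iff)
    moreover have "inj (map (\<lambda>x::nat. x + m))" by (simp add: inj_def)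
    ultimately have "card (?P ?B n) = card (?P A (n - m * l))"
      by (metis (lifting) card_image inj_on_subset subset_UNIV)
    then show ?thesis using False by (simp add: R gen_series_nth)
  qed
qed

section \<open>The automaton\<close>

text \<open>
  In a state \<open>(f, v)\<close>, \<open>v\<close> is the last part read and \<open>f\<close> keeps what is needed of the differences
  before it: the last one is 0 for \<open>Repeat\<close>, 4 for \<open>Four\<close>, at least 5 (or there is none) for \<open>Free\<close>,
  and 2 or 3 for \<open>Chain\<close> and \<open>Near\<close>, where \<open>Chain\<close> means that the differences end in 0, 3, 2, ..., 2,
  so that (N6) forbids 3 as the next one. Initial states with \<open>v \<le> 0\<close> act as fictitious smaller
  parts that encode the restrictions on parts 1, 2, 3 in the three sets.
\<close>

datatype flag = Repeat | Chain | Near | Four | Free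

type_synonym state = "flag \<times> int"

fun nxt :: "nat \<Rightarrow> state \<Rightarrow> state" where
  "nxt w (f, v) =
     (let d = int w - v in
      (if d = 0 then Repeat
       else if d = 2 then (if f = Chain then Chain else Near)
       else if d = 3 then (if f = Repeat then Chain else Near)
       else if d = 4 then Four
       else Free, int w))"

text \<open>With \<open>e\<close> the previous difference, (N2) and (N3) allow \<open>d = 0\<close>
  only for \<open>e \<ge> 4\<close>, and (N5) wants an even part if \<open>e = 4\<close>. After
  \<open>e = 0\<close>, (N2) excludes \<open>d = 2\<close>, while (N4) and (N5) want an even part
  for \<open>d = 3\<close> and \<open>d = 4\<close>. The value \<open>d = 1\<close> is absent by
  (N1).\<close>

fun ok :: "nat \<Rightarrow> state \<Rightarrow> bool" where
  "ok w (f, v) \<longleftrightarrow>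
     (let d = int w - v in
      d = 0 \<and> (f = Free \<or> f = Four \<and> even w) \<or>
      d = 2 \<and> f \<noteq> Repeat \<or>
      d = 3 \<and> f \<noteq> Chain \<and> (f = Repeat \<longrightarrow> even w) \<or>
      d = 4 \<and> (f = Repeat \<longrightarrow> even w) \<or>
      d \<ge> 5)"

text \<open>Lists decrease, so \<open>foldr\<close> reads the smallest part first and the head is
  the last part read.\<close>

fun good :: "state \<Rightarrow> nat list \<Rightarrow> bool" where
  "good s [] \<longleftrightarrow> True"
| "good s (x # xs) \<longleftrightarrow> x > 0 \<and> ok x (foldr nxt xs s) \<and> good s xs"

text \<open>Splits off the part read first, where the defining equations split off the one read
  last.\<close>

lemma good_snoc: "good s (xs @ [w]) \<longleftrightarrow> w > 0 \<and> ok w s \<and> good (nxt w s) xs"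
  by (induction xs) auto

lemma ok_ge: "ok w (f, v) \<Longrightarrow> v \<le> int w"
  by (auto simp: Let_def)

lemma snd_nxt: "snd (nxt w s) = int w"
  by (cases s) (simp add: Let_def)

lemma good_ge: "good (f, v) xs \<Longrightarrow> x \<in> set xs \<Longrightarrow> v \<le> int x"
proof (induction xs arbitrary: f v rule: rev_induct)
  case (snoc w xs)
  obtain g where g: "nxt w (f, v) = (g, int w)"
    using snd_nxt[of w "(f, v)"] by (metis prod.collapse)
  with snoc.prems have "ok w (f, v)" "good (g, int w) xs"
    by (auto simp: good_snoc simp del: nxt.simps ok.simps)
  moreover have "int w \<le> int x" if "x \<in> set xs"
    using snoc.IH[OF \<open>good (g, int w) xs\<close> that] .
  ultimately show ?case using snoc.prems(2) ok_ge[of w f v] by fastforce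
qed simp

lemma good_is_partition: "good s xs \<Longrightarrow> is_partition xs"
proof (induction xs arbitrary: s rule: rev_induct)
  case (snoc w xs)
  obtain f v where "nxt w s = (f, v)" by fastforce
  with snoc snd_nxt[of w s] good_ge[of f v xs] show ?case
    by (fastforce simp: good_snoc is_partition_def sorted_wrt_append)
qed (simp add: is_partition_def)

lemma nxt_shift: "nxt (w + 2) (f, v) = (case nxt w (f, v - 2) of (g, u) \<Rightarrow> (g, u + 2))"
proof -
  have d: "int (w + 2) - v = int w - (v - 2)" by simp
  show ?thesis unfolding nxt.simps d by (simp add: Let_def)
qed

lemma ok_shift: "ok (w + 2) (f, v) = ok w (f, v - 2)"
proof -
  have d: "int (w + 2) - v = int w - (v - 2)" by simp
  show ?thesis unfolding ok.simps d by (simp add: Let_def)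
qed

lemma good_shift:
  "(\<forall>x\<in>set xs. x > 0) \<Longrightarrow> good (f, v) (map (\<lambda>x. x + 2) xs) \<longleftrightarrow> good (f, v - 2) xs"
proof (induction xs arbitrary: f v rule: rev_induct)
  case (snoc w xs)
  obtain g u where "nxt w (f, v - 2) = (g, u)" by fastforce
  with snoc show ?case
    by (simp add: good_snoc nxt_shift ok_shift del: nxt.simps ok.simps add_2_eq_Suc')
qed simp

definition gf :: "flag \<Rightarrow> int \<Rightarrow> series" where
  "gf f v = gen_series (Collect (good (f, v)))"

lemma good_decompose:
  assumes "v \<le> 2"
  shows "Collect (good (f, v)) = map (\<lambda>x. x + 2) ` Collect (good (f, v - 2)) \<union>
     (if ok 1 (f, v) then (\<lambda>xs. xs @ [1]) ` Collect (good (nxt 1 (f, v))) else {}) \<union>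
     (if ok 2 (f, v) then (\<lambda>xs. xs @ [2]) ` Collect (good (nxt 2 (f, v))) else {})"
    (is "?L = ?R")
proof (intro equalityI subsetI)
  fix xs assume "xs \<in> ?L"
  then have g: "good (f, v) xs" by simp
  show "xs \<in> ?R"
  proof (cases xs rule: rev_cases)
    case Nil
    then show ?thesis by simp
  next
    case (snoc ys w)
    have "w > 0" using g snoc by (simp add: good_snoc del: nxt.simps ok.simps)
    then consider "w = 1" | "w = 2" | "w \<ge> 3" by linarith
    then show ?thesis
    proof cases
      case 3
      have "\<forall>x\<in>set xs. 3 \<le> x"
        using good_is_partition[OF g] 3 by (fastforce simp: snoc is_partition_def sorted_wrt_append)
      then have xs: "xs = map (\<lambda>x. x + 2) (map (\<lambda>x. x - 2) xs)"
        and pos: "\<forall>x\<in>set (map (\<lambda>x. x - 2) xs). x > 0"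
        by (auto intro!: map_idI[symmetric])
      then have "good (f, v - 2) (map (\<lambda>x. x - 2) xs)"
        using g good_shift[OF pos] by metis
      then show ?thesis using xs by blast
    qed (use g snoc in \<open>auto simp: good_snoc simp del: nxt.simps ok.simps\<close>)
  qed
next
  fix xs assume "xs \<in> ?R"
  moreover have "good (f, v) (map (\<lambda>x. x + 2) ys)" if "good (f, v - 2) ys" for ys
    using that good_shift good_is_partition by (metis is_partition_def)
  ultimately show "xs \<in> ?L"
    by (auto simp: good_snoc simp del: nxt.simps ok.simps add_2_eq_Suc' split: if_splits)
qed

text \<open>The states on the right again satisfy \<open>v \<le> 2\<close>, so the recursion can be
  iterated.\<close>

lemma gf_rec:
  assumes "v \<le> 2"
  shows "gf f v = qshift 2 (gf f (v - 2)) +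
     (if ok 1 (f, v) then varx * varq * gf (fst (nxt 1 (f, v))) 1 else 0) +
     (if ok 2 (f, v) then varx * varq ^ 2 * gf (fst (nxt 2 (f, v))) 2 else 0)"
proof -
  define A where "A = map (\<lambda>x. x + 2) ` Collect (good (f, v - 2))"
  define B where
    "B w = (if ok w (f, v) then (\<lambda>xs. xs @ [w]) ` Collect (good (nxt w (f, v))) else {})" for w
  have U: "Collect (good (f, v)) = A \<union> B 1 \<union> B 2"
    unfolding A_def B_def by (rule good_decompose[OF assms])
  then have P: "A \<union> B 1 \<union> B 2 \<subseteq> Collect is_partition"
    using good_is_partition by blast
  \<comment> \<open>The three pieces are disjoint because the smallest part is 1, 2, or at least 3
    (or there is none).\<close>
  have B_last: "ys \<noteq> [] \<and> last ys = w" if "ys \<in> B w" for ys w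
    using that by (auto simp: B_def simp del: nxt.simps ok.simps split: if_splits)
  have A_last: "ys = [] \<or> last ys > 2" if ys: "ys \<in> A" for ys
  proof -
    obtain zs where "good (f, v - 2) zs" "ys = map (\<lambda>x. x + 2) zs"
      using ys A_def by blast
    then show ?thesis
      using good_is_partition[of _ zs] by (cases zs rule: rev_cases) (auto simp: is_partition_def)
  qed
  have "A \<inter> B 1 = {}" "A \<inter> B 2 = {}"
    by (rule Int_emptyI, drule A_last, drule B_last, simp)+
  moreover have "B 1 \<inter> B 2 = {}"
    by (rule Int_emptyI, drule B_last, drule B_last, simp)
  ultimately have "A \<inter> B 1 = {}" "(A \<union> B 1) \<inter> B 2 = {}"
    by (simp_all only: Int_Un_distrib2 Un_empty_left)
  with P have un: "gen_series (A \<union> B 1 \<union> B 2) = gen_series A + gen_series (B 1) + gen_series (B 2)"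
    by (simp add: gen_series_Un)
  have "nxt w (f, v) = (fst (nxt w (f, v)), int w)" for w
    by (simp only: prod_eq_iff fst_conv snd_conv snd_nxt)
  then have N: "good (nxt w (f, v)) = good (fst (nxt w (f, v)), int w)" for w
    by (rule arg_cong)
  have B: "gen_series (B w) =
      (if ok w (f, v) then varx * varq ^ w * gf (fst (nxt w (f, v))) (int w) else 0)" for w
    unfolding B_def gf_def N[symmetric] by (simp only: gen_series_empty gen_series_snoc split: if_split)
      simp
  have A: "gen_series A = qshift 2 (gf f (v - 2))"
    unfolding A_def gf_def by (rule gen_series_map_add)
  have "gf f v = gen_series (A \<union> B 1 \<union> B 2)"
    by (simp only: gf_def U)
  then show ?thesis
    by (simp only: un A B power_one_right of_nat_1 of_nat_numeral)
qed

text \<open>The first part read is at distance at least 5 from \<open>v\<close>: it is accepted, and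
  the next state is \<open>Free\<close> whatever the flag was. Such a state imposes no initial
  restriction.\<close>

lemma gf_far:
  assumes "v \<le> -4" "u \<le> -4"
  shows "gf f v = gf g u"
proof -
  have "good (f, v) xs \<longleftrightarrow> good (g, u) xs" for xs
  proof (cases xs rule: rev_cases)
    case (snoc ys w)
    have "ok w (f, v)" "ok w (g, u)" "nxt w (f, v) = nxt w (g, u)" if "w > 0"
      using that assms by (auto simp: Let_def)
    then show ?thesis by (simp add: snoc good_snoc del: nxt.simps ok.simps cong: conj_cong)
  qed simp
  then have "good (f, v) = good (g, u)" by blast
  then show ?thesis by (simp only: gf_def)
qed

section \<open>The three sets as languages of states\<close>

lemma all_nat_split: "(\<forall>i. P i) \<longleftrightarrow> P 0 \<and> (\<forall>i. P (Suc i))"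
  by (metis not0_implies_Suc)

lemma diffs_Cons_Cons: "diffs (x # y # xs) = (x - y) # diffs (y # xs)"
  by (simp add: diffs_def upt_conv_Cons map_Suc_upt[symmetric] del: upt_Suc)

lemma diffs_small [simp]: "diffs [] = []" "diffs [x] = []"
  by (simp_all add: diffs_def)

text \<open>Marks the differences in front of which a further 3 completes the pattern of
  (N6).\<close>

definition linked :: "nat list \<Rightarrow> bool" where
  "linked ds \<longleftrightarrow> (\<exists>k. prefix (replicate k 2 @ [3, 0]) ds)"

lemma linked_Nil [simp]: "\<not> linked []"
  by (simp add: linked_def)

text \<open>Mirrors the transitions of \<open>nxt\<close> into \<open>Chain\<close>: a 2 preserves
  it, a 3 after a 0 creates it.\<close>

lemma linked_Cons: "linked (d # ds) \<longleftrightarrow> d = 2 \<and> linked ds \<or> d = 3 \<and> prefix [0] ds"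
proof -
  have "linked (d # ds) \<longleftrightarrow> (\<exists>k. prefix (replicate (Suc k) 2 @ [3, 0]) (d # ds)) \<or> prefix [3, 0] (d # ds)"
    unfolding linked_def by (metis append_Nil not0_implies_Suc replicate_0)
  then show ?thesis by (auto simp: linked_def)
qed

lemma sublist_linked_Cons:
  "(\<forall>k. \<not> sublist ([3] @ replicate k 2 @ [3, 0]) (d # ds)) \<longleftrightarrow>
   (\<forall>k. \<not> sublist ([3] @ replicate k 2 @ [3, 0]) ds) \<and> \<not> (d = 3 \<and> linked ds)"
  by (auto simp: sublist_Cons_right linked_def)

lemma setN_Nil: "[] \<in> setN"
  by (simp add: setN_def is_partition_def)

lemma setN_single: "[x] \<in> setN \<longleftrightarrow> x > 0"
  by (simp add: setN_def is_partition_def)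

lemma setN_pair: "[x, y] \<in> setN \<longleftrightarrow> y > 0 \<and> x \<ge> y \<and> x \<noteq> y + 1"
  by (auto simp: setN_def is_partition_def diffs_Cons_Cons sublist_Cons_right)

text \<open>Only the windows at index 0 are new, and a new occurrence of the (N6) pattern must be a
  prefix of the differences.\<close>

lemma setN_Cons:
  "x # y # z # xs \<in> setN \<longleftrightarrow> y # z # xs \<in> setN \<and> x \<ge> y \<and> x \<noteq> y + 1 \<and> x \<ge> z + 3 \<and>
     (x = z + 3 \<longrightarrow> x \<noteq> y \<and> (odd x \<longrightarrow> y \<noteq> z)) \<and>
     (x = z + 4 \<and> odd x \<longrightarrow> x \<noteq> y \<and> y \<noteq> z) \<and>
     \<not> (x = y + 3 \<and> linked (diffs (y # z # xs)))"
proof -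
  have p: "is_partition (x # y # z # xs) \<longleftrightarrow> is_partition (y # z # xs) \<and> x \<ge> y"
    by (auto simp: is_partition_def)
  have "x # y # z # xs \<in> setN \<longleftrightarrow> y # z # xs \<in> setN \<and> x \<ge> y \<and> x - y \<noteq> 1 \<and> x - z \<ge> 3 \<and>
     (x - z = 3 \<longrightarrow> x \<noteq> y) \<and> (x - z = 3 \<and> odd x \<longrightarrow> y \<noteq> z) \<and>
     (x - z = 4 \<and> odd x \<longrightarrow> x \<noteq> y \<and> y \<noteq> z) \<and>
     \<not> (x - y = 3 \<and> linked (diffs (y # z # xs)))"
    unfolding setN_def mem_Collect_eq p diffs_Cons_Cons[of x] sublist_linked_Cons
    by (subst (1 2 3 4 5) all_nat_split) auto
  moreover have "z \<le> y" if "y # z # xs \<in> setN"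
    using that by (simp add: setN_def is_partition_def)
  ultimately show ?thesis by (smt (verit) add.commute add_diff_inverse_nat diff_add_inverse le_add_diff_inverse leD le_diff_conv le_trans)
qed

section \<open>Reading the flag of a run off the differences\<close>

lemma ok_int: "ok x (f, int y) \<longleftrightarrow>
    x = y \<and> (f = Free \<or> f = Four \<and> even x) \<or>
    x = y + 2 \<and> f \<noteq> Repeat \<or>
    x = y + 3 \<and> f \<noteq> Chain \<and> (f = Repeat \<longrightarrow> even x) \<or>
    x = y + 4 \<and> (f = Repeat \<longrightarrow> even x) \<or>
    x \<ge> y + 5"
proof -
  have "int x - int y = 0 \<longleftrightarrow> x = y" "int x - int y = 2 \<longleftrightarrow> x = y + 2"
    "int x - int y = 3 \<longleftrightarrow> x = y + 3" "int x - int y = 4 \<longleftrightarrow> x = y + 4"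
    "int x - int y \<ge> 5 \<longleftrightarrow> x \<ge> y + 5"
    by linarith+
  then show ?thesis by (simp only: ok.simps Let_def)
qed

lemma nxt_int: "nxt x (f, int y) =
    (if x = y then Repeat
     else if x = y + 2 then (if f = Chain then Chain else Near)
     else if x = y + 3 then (if f = Repeat then Chain else Near)
     else if x = y + 4 then Four
     else Free, int x)"
proof -
  have "int x - int y = 0 \<longleftrightarrow> x = y" "int x - int y = 2 \<longleftrightarrow> x = y + 2"
    "int x - int y = 3 \<longleftrightarrow> x = y + 3" "int x - int y = 4 \<longleftrightarrow> x = y + 4"
    by linarith+
  then show ?thesis by (simp only: nxt.simps Let_def)
qed

lemma foldr_nxt_Cons: "\<exists>f. foldr nxt (x # xs) s = (f, int x)"
  by (metis prod.collapse snd_nxt foldr.simps(2) comp_apply)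

text \<open>Once two parts have been read, the start state matters only through the question whether
  the flag is \<open>Chain\<close>; everything else is determined by \<open>y - z\<close>.\<close>

lemma good_Cons_Cons_Cons:
  assumes "good s (y # z # r)"
  shows "good s (x # y # z # r) \<longleftrightarrow> x \<ge> y \<and> x \<noteq> y + 1 \<and> x \<ge> z + 3 \<and>
     (x = z + 3 \<longrightarrow> x \<noteq> y \<and> (odd x \<longrightarrow> y \<noteq> z)) \<and>
     (x = z + 4 \<and> odd x \<longrightarrow> x \<noteq> y \<and> y \<noteq> z) \<and>
     \<not> (x = y + 3 \<and> fst (foldr nxt (y # z # r) s) = Chain)"
proof -
  obtain f where f: "foldr nxt (z # r) s = (f, int z)"
    using foldr_nxt_Cons by blast
  obtain g where g: "nxt y (f, int z) = (g, int y)"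
    by (simp only: nxt_int)
  then have "foldr nxt (y # z # r) s = (g, int y)"
    using f by simp
  then have good: "good s (x # y # z # r) \<longleftrightarrow> x > 0 \<and> ok x (g, int y)"
    and fst: "fst (foldr nxt (y # z # r) s) = g"
    using assms by simp_all
  have y: "y > 0" "ok y (f, int z)" using assms f by simp_all
  \<comment> \<open>The difference \<open>y - z\<close> fixes the flag except for the choice between
    \<open>Chain\<close> and \<open>Near\<close> at 2 and 3.\<close>
  from y(2) g consider "y = z" "g = Repeat" | "y = z + 2" "g = Chain" | "y = z + 2" "g = Near"
    | "y = z + 3" "g = Chain" | "y = z + 3" "g = Near" | "y = z + 4" "g = Four" | "y \<ge> z + 5" "g = Free"
    unfolding ok_int nxt_int by (auto split: if_splits)
  then show ?thesis
    unfolding good fst ok_int using y(1) by cases (simp_all, presburger+)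
qed

lemma good_appendD: "good s (xs @ ys) \<Longrightarrow> good s ys"
  by (induction xs) auto

text \<open>\<open>Chain\<close> arises either from the differences or from the start state;
  \<open>P\<close> describes the lists along which a flag \<open>Chain\<close> of the start state
  survives. A single part has no differences, so it must not lead to \<open>Repeat\<close>.\<close>

lemma run_Chain_iff:
  assumes "good s (x # xs)"
    and "\<And>x. good s [x] \<Longrightarrow> fst (nxt x s) = Chain \<longleftrightarrow> P [x]"
    and "\<And>x. good s [x] \<Longrightarrow> fst (nxt x s) \<noteq> Repeat"
    and "\<And>x y xs. good s (x # y # xs) \<Longrightarrow> P (x # y # xs) \<longleftrightarrow> x = y + 2 \<and> P (y # xs)"
  shows "fst (foldr nxt (x # xs) s) = Chain \<longleftrightarrow> linked (diffs (x # xs)) \<or> P (x # xs)"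
  using assms(1)
proof (induction xs arbitrary: x)
  case Nil
  then show ?case using assms(2) by simp
next
  case (Cons y r)
  define f where "f = fst (foldr nxt (y # r) s)"
  have f: "foldr nxt (y # r) s = (f, int y)"
    by (simp add: f_def prod_eq_iff snd_nxt del: nxt.simps)
  have x: "ok x (f, int y)" and good: "good s (y # r)" using Cons.prems f by simp_all
  have IH: "f = Chain \<longleftrightarrow> linked (diffs (y # r)) \<or> P (y # r)"
    unfolding f_def by (rule Cons.IH[OF good])
  have R: "prefix [0] (diffs (y # r)) \<longleftrightarrow> f = Repeat"
  proof (cases r)
    case (Cons z t)
    obtain g where g: "foldr nxt (z # t) s = (g, int z)"
      using foldr_nxt_Cons by blast
    have "ok y (g, int z)" "f = fst (nxt y (g, int z))"
      using good g by (simp_all add: Cons f_def)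
    then show ?thesis
      unfolding ok_int nxt_int by (auto simp: Cons diffs_Cons_Cons split: if_splits)
  next
    case Nil
    then show ?thesis using assms(3)[of y] good by (simp add: f_def)
  qed
  have "fst (foldr nxt (x # y # r) s) = fst (nxt x (f, int y))" using f by simp
  also have "\<dots> = Chain \<longleftrightarrow> x = y + 2 \<and> f = Chain \<or> x = y + 3 \<and> f = Repeat"
    unfolding nxt_int by simp
  also have "\<dots> \<longleftrightarrow> linked (diffs (x # y # r)) \<or> P (x # y # r)"
    using x assms(4)[OF Cons.prems] IH R unfolding diffs_Cons_Cons linked_Cons ok_int by auto
  finally show ?case .
qed

lemma setN_tail: "x # xs \<in> setN \<Longrightarrow> xs \<in> setN"
proof (cases xs rule: remdups_adj.cases)
  case (3 y z r)
  then show "x # xs \<in> setN \<Longrightarrow> xs \<in> setN" using setN_Cons[of x y z r] by blast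
qed (simp_all add: setN_Nil setN_single setN_pair)

section \<open>The start states of the three sets\<close>

lemma ok_nxt_Chain_minus2:
  assumes "y > 0"
  shows "ok y (Chain, -2) \<longleftrightarrow> y \<ge> 2"
    and "ok y (Chain, -2) \<Longrightarrow> nxt y (Chain, -2) = (if y = 2 then Four else Free, int y)"
  using assms by (auto simp: Let_def)

text \<open>Measured from -2, a first part 1 is at distance 3, which \<open>Chain\<close> refuses; 2
  is at distance 4 and even, hence repeatable; larger parts are free.\<close>

lemma setN1_eq: "setN1 = Collect (good (Chain, -2))"
proof -
  have "xs \<in> setN1 \<longleftrightarrow> good (Chain, -2) xs" for xs
  proof (induction xs rule: induct_list012)
    case 1
    show ?case by (simp add: setN1_def setN_Nil)
  next
    case (2 x)
    show ?case by (auto simp: setN1_def setN_single ok_nxt_Chain_minus2(1) simp del: ok.simps)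
  next
    case (3 x y r)
    show ?case
    proof (cases "good (Chain, -2) (y # r)")
      case False
      then have "y # r \<notin> setN1" using 3(2) by simp
      then have "x # y # r \<notin> setN1"
        unfolding setN1_def mem_Collect_eq count_list.simps(2)[of x] using setN_tail[of x "y # r"]
        by (auto split: if_splits)
      then show ?thesis using False by simp
    next
      case good: True
      then have "y # r \<in> setN1" using 3(2) by simp
      then have c: "count_list (y # r) 1 = 0" and N: "y # r \<in> setN"
        by (simp_all add: setN1_def)
      show ?thesis
      proof (cases r)
        case Nil
        have y: "y > 0" "ok y (Chain, -2)"
          using good unfolding Nil by (simp_all del: ok.simps nxt.simps)
        have G: "good (Chain, -2) (x # y # r) \<longleftrightarrow> x > 0 \<and> ok x (if y = 2 then Four else Free, int y)"
          using good ok_nxt_Chain_minus2(2)[OF y] unfolding Nil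
          by (simp del: ok.simps nxt.simps)
        consider "y = 2" | "y \<ge> 3"
          using y ok_nxt_Chain_minus2(1)[OF y(1)] by linarith
        then show ?thesis
          unfolding G unfolding Nil setN1_def mem_Collect_eq setN_pair ok_int
          by cases (simp_all, presburger+)
      next
        case (Cons z t)
        \<comment> \<open>The first part is at distance at least 4, so the initial
          \<open>Chain\<close> is lost at once.\<close>
        have R: "fst (foldr nxt (y # r) (Chain, -2)) = Chain \<longleftrightarrow> linked (diffs (y # r)) \<or> False"
          by (rule run_Chain_iff[OF good]) (auto simp: ok_nxt_Chain_minus2(2) simp del: ok.simps nxt.simps)
        have z: "z > 0" using good by (simp add: Cons)
        show ?thesis
        \<comment> \<open>Both sides require \<open>x \<ge> z + 3\<close>, hence
          \<open>x \<ge> 4\<close>, so the new part changes none of the restricted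
          multiplicities.\<close>
        proof (cases "x \<ge> z + 3")
          case True
          with z have "x \<noteq> 1" "x \<noteq> 2" "x \<noteq> 3" by linarith+
          with c N show ?thesis
            unfolding Cons setN1_def mem_Collect_eq setN_Cons good_Cons_Cons_Cons[OF good[unfolded Cons]]
              R[unfolded Cons] count_list.simps(2)[of x]
            by simp
        next
          case False
          then show ?thesis
            unfolding Cons setN1_def mem_Collect_eq setN_Cons good_Cons_Cons_Cons[OF good[unfolded Cons]]
            by simp
        qed
      qed
    qed
  qed
  then show ?thesis by blast
qed

lemma ok_nxt_Free_minus1:
  assumes "y > 0"
  shows "ok y (Free, -1) \<longleftrightarrow> True"
    and "ok y (Free, -1) \<Longrightarrow> nxt y (Free, -1) = (if y \<le> 2 then Near else if y = 3 then Four else Free, int y)"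
  using assms by (auto simp: Let_def)

text \<open>Measured from -1, the parts 1 and 2 lead to \<open>Near\<close>, and 3 leads to
  \<open>Four\<close> at an odd value, so none of them can be repeated; larger parts are
  free.\<close>

lemma setN2_eq: "setN2 = Collect (good (Free, -1))"
proof -
  have "xs \<in> setN2 \<longleftrightarrow> good (Free, -1) xs" for xs
  proof (induction xs rule: induct_list012)
    case 1
    show ?case by (simp add: setN2_def setN_Nil)
  next
    case (2 x)
    show ?case by (auto simp: setN2_def setN_single ok_nxt_Free_minus1(1) simp del: ok.simps)
  next
    case (3 x y r)
    show ?case
    proof (cases "good (Free, -1) (y # r)")
      case False
      then have "y # r \<notin> setN2" using 3(2) by simp
      then have "x # y # r \<notin> setN2"
        unfolding setN2_def mem_Collect_eq count_list.simps(2)[of x] using setN_tail[of x "y # r"]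
        by (auto split: if_splits)
      then show ?thesis using False by simp
    next
      case good: True
      then have "y # r \<in> setN2" using 3(2) by simp
      then have c: "\<forall>i\<in>{1, 2, 3}. count_list (y # r) i \<le> 1" and N: "y # r \<in> setN"
        by (simp_all add: setN2_def)
      show ?thesis
      proof (cases r)
        case Nil
        have y: "y > 0" "ok y (Free, -1)"
          using good unfolding Nil by (simp_all del: ok.simps nxt.simps)
        have G: "good (Free, -1) (x # y # r) \<longleftrightarrow> x > 0 \<and> ok x (if y \<le> 2 then Near else if y = 3 then Four else Free, int y)"
          using good ok_nxt_Free_minus1(2)[OF y] unfolding Nil
          by (simp del: ok.simps nxt.simps)
        consider "y = 1" | "y = 2" | "y = 3" | "y \<ge> 4"
          using y ok_nxt_Free_minus1(1)[OF y(1)] by linarith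
        then show ?thesis
          unfolding G unfolding Nil setN2_def mem_Collect_eq setN_pair ok_int
          by cases (simp_all, presburger+)
      next
        case (Cons z t)
        have R: "fst (foldr nxt (y # r) (Free, -1)) = Chain \<longleftrightarrow> linked (diffs (y # r)) \<or> False"
          by (rule run_Chain_iff[OF good]) (auto simp: ok_nxt_Free_minus1(2) simp del: ok.simps nxt.simps)
        have z: "z > 0" using good by (simp add: Cons)
        show ?thesis
        proof (cases "x \<ge> z + 3")
          case True
          with z have "x \<noteq> 1" "x \<noteq> 2" "x \<noteq> 3" by linarith+
          with c N show ?thesis
            unfolding Cons setN2_def mem_Collect_eq setN_Cons good_Cons_Cons_Cons[OF good[unfolded Cons]]
              R[unfolded Cons] count_list.simps(2)[of x]
            by simp
        next
          case False
          then show ?thesis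
            unfolding Cons setN2_def mem_Collect_eq setN_Cons good_Cons_Cons_Cons[OF good[unfolded Cons]]
            by simp
        qed
      qed
    qed
  qed
  then show ?thesis by blast
qed

lemma ok_nxt_Chain_0:
  assumes "y > 0"
  shows "ok y (Chain, 0) \<longleftrightarrow> y \<noteq> 1 \<and> y \<noteq> 3"
    and "ok y (Chain, 0) \<Longrightarrow>
      nxt y (Chain, 0) = (if y = 2 then Chain else if y = 4 then Four else Free, int y)"
  using assms by (auto simp: Let_def)

primrec stair :: "nat \<Rightarrow> nat list" where
  "stair 0 = []"
| "stair (Suc k) = 2 * Suc k # stair k"

lemma stair_eq: "map (\<lambda>j. 2 * j) (rev [1..<k + 1]) = stair k"
  by (induction k) simp_all

lemma stair_snoc: "k \<ge> 1 \<Longrightarrow> \<exists>xs. stair k = xs @ [2]"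
  by (induction k rule: dec_induct) auto

lemma Cons_eq_stair: "x # xs = stair k \<longleftrightarrow> (\<exists>j. k = Suc j \<and> x = 2 * k \<and> xs = stair j)"
  by (cases k) auto

lemma good_Chain_2: "good (Chain, 0) (2 # ys) \<Longrightarrow> ys = []"
proof (rule ccontr)
  assume g: "good (Chain, 0) (2 # ys)" and "ys \<noteq> []"
  then obtain w ws where ys: "ys = w # ws" by (meson neq_Nil_conv)
  show False
  proof (cases ws)
    case Nil
    have w: "w > 0" "ok w (Chain, 0)" using g by (simp_all add: ys Nil del: ok.simps nxt.simps)
    then have "ok 2 (if w = 2 then Chain else if w = 4 then Four else Free, int w)"
      using g ok_nxt_Chain_0(2)[OF w] by (simp add: ys Nil del: ok.simps nxt.simps)
    then show False using w ok_nxt_Chain_0(1)[OF w(1)] unfolding ok_int by (auto split: if_splits)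
  next
    case (Cons u us)
    then have "good (Chain, 0) (w # u # us)" using g ys by simp
    from good_Cons_Cons_Cons[OF this] g show False by (simp add: ys Cons del: good.simps)
  qed
qed

text \<open>The staircase ends in 2, and from this start state nothing can be read before a
  2.\<close>

lemma prefix_stair:
  assumes "k \<ge> 1" "good (Chain, 0) xs"
  shows "prefix (stair k) xs \<longleftrightarrow> xs = stair k"
proof
  assume "prefix (stair k) xs"
  then obtain ys where xs: "xs = stair k @ ys" by (auto simp: prefix_def)
  obtain zs where "stair k = zs @ [2]" using stair_snoc assms(1) by blast
  then have "good (Chain, 0) (2 # ys)"
    using assms(2) xs good_appendD[of _ zs "2 # ys"] by simp
  then show "xs = stair k" using good_Chain_2 xs by simp
qed simp

lemma sublist_stair_Cons:
  assumes "good (Chain, 0) xs"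
  shows "(\<forall>k\<ge>1. \<not> sublist ((2 * k + 3) # stair k) (x # xs)) \<longleftrightarrow>
    (\<forall>k\<ge>1. \<not> sublist ((2 * k + 3) # stair k) xs) \<and> \<not> (\<exists>k\<ge>1. x = 2 * k + 3 \<and> xs = stair k)"
  by (auto simp: sublist_Cons_right prefix_stair[OF _ assms])

text \<open>Measured from 0, the parts 1 and 3 are refused, while 2 keeps \<open>Chain\<close> and
  so cannot be repeated. Exactly the staircases 2, 4, ..., 2k keep the initial \<open>Chain\<close>,
  which then refuses 2k+3.\<close>

lemma setN3_eq: "setN3 = Collect (good (Chain, 0))"
proof -
  let ?P = "\<lambda>xs. \<exists>k\<ge>1. xs = stair k"
  have P1: "?P [x] \<longleftrightarrow> x = 2" for x
  proof -
    have "[] = stair j \<longleftrightarrow> j = 0" for j by (cases j) auto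
    then show ?thesis unfolding Cons_eq_stair by auto
  qed
  have P2: "?P (x # y # xs) \<longleftrightarrow> x = y + 2 \<and> ?P (y # xs)" for x y xs
  proof
    assume "?P (x # y # xs)"
    then obtain j where "x = 2 * Suc j" "y # xs = stair j"
      unfolding Cons_eq_stair[of x] by blast
    moreover from this obtain i where "j = Suc i" "y = 2 * j"
      unfolding Cons_eq_stair by blast
    ultimately show "x = y + 2 \<and> ?P (y # xs)" by auto
  next
    assume "x = y + 2 \<and> ?P (y # xs)"
    moreover from this obtain k where "y # xs = stair k" "y = 2 * k"
      unfolding Cons_eq_stair by blast
    ultimately have "x # y # xs = stair (Suc k)" by simp
    then show "?P (x # y # xs)" by (metis One_nat_def Suc_le_mono le0)
  qed
  have P3: "(\<exists>k\<ge>1. x = 2 * k + 3 \<and> y # r = stair k) \<longleftrightarrow> x = y + 3 \<and> ?P (y # r)" for x y r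
    unfolding Cons_eq_stair by auto
  have "xs \<in> setN3 \<longleftrightarrow> good (Chain, 0) xs" for xs
  proof (induction xs rule: induct_list012)
    case 1
    show ?case by (simp add: setN3_def setN_Nil)
  next
    case (2 x)
    have "\<not> sublist ((2 * k + 3) # stair k) [x]" if "k \<ge> 1" for k
      using that by (cases k) (auto simp: sublist_Cons_right)
    then have "[x] \<in> setN3 \<longleftrightarrow> x > 0 \<and> x \<noteq> 1 \<and> x \<noteq> 3"
      unfolding setN3_def stair_eq mem_Collect_eq setN_single by auto
    then show ?case by (auto simp: ok_nxt_Chain_0(1) simp del: ok.simps)
  next
    case (3 x y r)
    show ?case
    proof (cases "good (Chain, 0) (y # r)")
      case False
      then have "y # r \<notin> setN3" using 3(2) by simp
      then have "x # y # r \<notin> setN3"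
        unfolding setN3_def stair_eq mem_Collect_eq count_list.simps using setN_tail[of x "y # r"]
        by (auto simp: sublist_Cons_right simp del: upt_Suc split: if_splits)
      then show ?thesis using False by simp
    next
      case good: True
      then have "y # r \<in> setN3" using 3(2) by simp
      then have S: "x # y # r \<in> setN3 \<longleftrightarrow> x # y # r \<in> setN \<and>
          count_list (x # y # r) 1 = 0 \<and> count_list (x # y # r) 3 = 0 \<and>
          count_list (x # y # r) 2 \<le> 1 \<and> \<not> (x = y + 3 \<and> ?P (y # r))"
        unfolding setN3_def stair_eq mem_Collect_eq sublist_stair_Cons[OF good] P3 by simp
      show ?thesis
      proof (cases r)
        case Nil
        have y: "y > 0" "ok y (Chain, 0)"
          using good unfolding Nil by (simp_all del: ok.simps nxt.simps)
        have G: "good (Chain, 0) (x # y # r) \<longleftrightarrow> x > 0 \<and>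
            ok x (if y = 2 then Chain else if y = 4 then Four else Free, int y)"
          using good ok_nxt_Chain_0(2)[OF y] unfolding Nil
          by (simp del: ok.simps nxt.simps)
        consider "y = 2" | "y = 4" | "y \<ge> 5"
          using y ok_nxt_Chain_0(1)[OF y(1)] by linarith
        then show ?thesis
          unfolding S G unfolding Nil P1 setN_pair ok_int
          by cases (simp_all, presburger+)
      next
        case (Cons z t)
        have R: "fst (foldr nxt (y # r) (Chain, 0)) = Chain \<longleftrightarrow> linked (diffs (y # r)) \<or> ?P (y # r)"
        proof (rule run_Chain_iff[OF good])
          show "fst (nxt w (Chain, 0)) = Chain \<longleftrightarrow> ?P [w]" if "good (Chain, 0) [w]" for w
            using that unfolding P1 by (auto simp: ok_nxt_Chain_0(2) simp del: ok.simps nxt.simps)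
          show "fst (nxt w (Chain, 0)) \<noteq> Repeat" if "good (Chain, 0) [w]" for w
            using that by (auto simp: ok_nxt_Chain_0(2) simp del: ok.simps nxt.simps)
        qed (rule P2)
        have c: "count_list (y # r) 1 = 0" "count_list (y # r) 3 = 0" "count_list (y # r) 2 \<le> 1"
          and "y # r \<in> setN"
          using \<open>y # r \<in> setN3\<close> by (simp_all add: setN3_def)
        have z: "z > 0" using good by (simp add: Cons)
        show ?thesis
        proof (cases "x \<ge> z + 3")
          case True
          with z have "x \<noteq> 1" "x \<noteq> 2" "x \<noteq> 3" by linarith+
          with c \<open>y # r \<in> setN\<close> show ?thesis
            unfolding S unfolding Cons setN_Cons good_Cons_Cons_Cons[OF good[unfolded Cons]]
              R[unfolded Cons] count_list.simps(2)[of x]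
            by (simp del: stair.simps) blast
        next
          case False
          then show ?thesis
            unfolding S unfolding Cons setN_Cons good_Cons_Cons_Cons[OF good[unfolded Cons]]
            by simp
        qed
      qed
    qed
  qed
  then show ?thesis by blast
qed

section \<open>Elimination in a system of q-difference equations\<close>

text \<open>Certificates for the elimination: with explicit multipliers \<open>k1\<close>, ..., what
  remains is a polynomial identity.\<close>

lemma lincomb1: "l1 = r1 \<Longrightarrow> L - R = k1 * (l1 - r1) \<Longrightarrow> L = R"
  for L :: "'a::ring"
  by simp

lemma lincomb3:
  "l1 = r1 \<Longrightarrow> l2 = r2 \<Longrightarrow> l3 = r3 \<Longrightarrow>
    L - R = k1 * (l1 - r1) + k2 * (l2 - r2) + k3 * (l3 - r3) \<Longrightarrow> L = R"
  for L :: "'a::ring"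
  by simp

text \<open>
  \<open>T\<close> stands for \<open>x \<mapsto> x q\<^sup>2\<close>; \<open>a\<close>, \<open>b\<close>, \<open>c\<close> will be the series of \<open>setN2\<close>, \<open>setN3\<close>,
  \<open>setN1\<close>, and \<open>e\<close> that of \<open>setN\<close>. In the equations for \<open>a\<close> and \<open>c\<close>, the other unknown is first
  reduced to a monomial times some \<open>T\<^sup>k b\<close>, which the first-order equation for \<open>b\<close> then cancels
  without any division.
\<close>

locale q_difference_system =
  fixes T :: "'a::idom \<Rightarrow> 'a" and x q a b c e g h :: 'a
  assumes T_add: "T (u + v) = T u + T v" and T_mult: "T (u * v) = T u * T v" and T_1: "T 1 = 1"
    and T_x: "T x = x * q ^ 2" and T_q: "T q = q"
    and b: "b = T c + x * q ^ 2 * T b"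
    and g: "g = T h + x * q ^ 2 * T g"
    and a: "a = g + x * q * T a"
    and h: "h = c + x * q * T a"
    and e: "e = h + (x * q) ^ 2 * T b"
    and c: "c = T e + x * q ^ 2 * T g + (x * q ^ 2) ^ 2 * T (T c)"
begin

lemma T_diff: "T (u - v) = T u - T v"
  using T_add[of "u - v" v] by (simp add: algebra_simps)

lemma T_minus: "T (- u) = - T u"
  using T_diff[of 0 u] T_diff[of 0 0] by simp

lemma T_power: "T (u ^ n) = T u ^ n"
  by (induction n) (simp_all add: T_1 T_mult)

lemmas T_simps = T_add T_mult T_1 T_x T_q T_diff T_minus T_power

lemma g_T: "g = T c + x * q ^ 3 * T (T a) + x * q ^ 2 * T g"
  by (rule lincomb3[OF g arg_cong[OF h, of T] refl[of 0], of _ _ 1 1 0, unfolded T_simps]) algebra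

lemma c_g: "c = g + x ^ 2 * q ^ 6 * T (T b) + x ^ 2 * q ^ 4 * T (T c)"
  by (rule lincomb3[OF c g arg_cong[OF e, of T], of _ _ 1 "-1" 1, unfolded T_simps]) algebra

lemma T_a: "T a = T g + x * q ^ 3 * T (T a)"
  by (rule lincomb1[OF arg_cong[OF a, of T], of _ _ 1, unfolded T_simps]) algebra

lemma TT_a: "T (T a) = T (T g) + x * q ^ 5 * T (T (T a))"
  by (rule lincomb1[OF arg_cong[OF T_a, of T], of _ _ 1, unfolded T_simps]) algebra

lemma T_g: "T g = T (T c) + x * q ^ 5 * T (T (T a)) + x * q ^ 4 * T (T g)"
  by (rule lincomb1[OF arg_cong[OF g_T, of T], of _ _ 1, unfolded T_simps]) algebra

lemma T_c: "T c = b - x * q ^ 2 * T b"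
  by (rule lincomb1[OF b, of _ _ "-1"]) algebra

text \<open>Eliminates \<open>g\<close>, using \<open>T_a\<close> for \<open>T g\<close>; all
  \<open>T^k c\<close> with \<open>k \<ge> 1\<close> thereby become expressions in
  \<open>a\<close>.\<close>

lemma a_b: "a - x * (q + q ^ 2) * T a - x * q ^ 3 * (1 - x * q ^ 2) * T (T a) = T c"
  by (rule lincomb3[OF a g_T T_a, of _ _ 1 1 "- (x * q ^ 2)"]) algebra

text \<open>The image of \<open>c_g\<close> under \<open>T\<close>, with \<open>g\<close> removed by
  \<open>T_g\<close> and \<open>TT_a\<close>. Given \<open>a_b\<close>, only the right-hand side
  still involves an unknown other than \<open>a\<close>.\<close>

lemma c_a:
  "T c - T (T c) - x ^ 2 * q ^ 8 * T (T (T c)) - x * q ^ 4 * T (T a)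
    - x * q ^ 5 * (1 - x * q ^ 4) * T (T (T a)) = x ^ 2 * q ^ 10 * T (T (T b))"
  by (rule lincomb3[OF arg_cong[OF c_g, of T] T_g TT_a, of _ _ 1 1 "- (x * q ^ 4)", unfolded T_simps])
     algebra

lemma equation_a:
  "0 = a + (- 1 - x * (q + q^2 + q^4)) * T a + x * q^4 * (1 + x * q + x * q^3) * T (T a) +
    x^2 * q^10 * (- 1 + x * q^4 + x * q^6) * T (T (T a)) +
    x^3 * q^15 * (1 + q^2 + q^3) * (1 - x * q^6) * T (T (T (T a))) +
    x^3 * q^19 * (1 - x * q^6) * (1 - x * q^8) * T (T (T (T (T a))))"
proof -
  define s where "s = T c - T (T c) - x ^ 2 * q ^ 8 * T (T (T c)) - x * q ^ 4 * T (T a)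
    - x * q ^ 5 * (1 - x * q ^ 4) * T (T (T a))"
  have s: "s = x ^ 2 * q ^ 10 * T (T (T b))"
    unfolding s_def by (rule c_a)
  have T4c: "T (T (T (T c))) = T (T (T b)) - x * q ^ 8 * T (T (T (T b)))"
    by (rule lincomb1[OF arg_cong[OF T_c, of "\<lambda>u. T (T (T u))"], of _ _ 1, unfolded T_simps]) algebra
  \<comment> \<open>\<open>T\<close> multiplies \<open>x^2\<close> by \<open>q^4\<close>, so the
    factor \<open>x q^4\<close> produces the \<open>x q^8\<close> of \<open>T4c\<close>.\<close>
  have "s - x * q ^ 4 * T s = x ^ 2 * q ^ 10 * T (T (T (T c)))"
    by (rule lincomb3[OF s arg_cong[OF s, of T] T4c, of _ _ 1 "- (x * q ^ 4)" "- (x ^ 2 * q ^ 10)",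
          unfolded T_simps]) algebra
  then show ?thesis
    unfolding s_def a_b[symmetric] T_simps by (rule lincomb1[where ?k1.0 = "-1"]) algebra
qed

text \<open>In \<open>g_T\<close> minus \<open>x q^3\<close> times \<open>T_g\<close>, the unknown
  \<open>a\<close> occurs only through \<open>T^2 a - x q^5 T^3 a\<close>, which is
  \<open>T^2 g\<close>.\<close>

lemma g_c:
  "g - x * (q ^ 2 + q ^ 3) * T g - x * q ^ 3 * (1 - x * q ^ 4) * T (T g) = T c - x * q ^ 3 * T (T c)"
  by (rule lincomb3[OF g_T T_g TT_a, of _ _ 1 "- (x * q ^ 3)" "x * q ^ 3"]) algebra

lemma equation_c:
  "0 = c + (- 1 - x * (q^2 + q^3 + q^4)) * T c +
     x * q^4 * (1 - x + x * q^3 + x * q^4 + x * q^5) * T (T c) +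
     x^2 * q^6 * (- 1 + x * q^4 * (1 + q + q^2 - q^5)) * T (T (T c)) +
     x^3 * q^13 * (1 + q + q^2) * (1 - x * q^6) * T (T (T (T c))) +
     x^3 * q^17 * (1 - x * q^6) * (1 - x * q^8) * T (T (T (T (T c))))"
proof -
  \<comment> \<open>By \<open>c_g\<close>, \<open>k\<close> is \<open>g\<close> up to a multiple of
    \<open>T^2 b\<close>; \<open>s\<close> measures how far \<open>k\<close> fails to satisfy
    \<open>g_c\<close>.\<close>
  define k where "k = c - x ^ 2 * q ^ 4 * T (T c)"
  define s where "s = k - x * (q ^ 2 + q ^ 3) * T k - x * q ^ 3 * (1 - x * q ^ 4) * T (T k)
    - T c + x * q ^ 3 * T (T c)"
  have g: "g = k - x ^ 2 * q ^ 6 * T (T b)"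
    unfolding k_def by (rule lincomb1[OF c_g, of _ _ "-1"]) algebra
  have T2b: "T (T b) = T (T (T c)) + x * q ^ 6 * T (T (T b))"
    by (rule lincomb1[OF arg_cong[OF b, of "\<lambda>u. T (T u)"], of _ _ 1, unfolded T_simps]) algebra
  have T3b: "T (T (T b)) = T (T (T (T c))) + x * q ^ 8 * T (T (T (T b)))"
    by (rule lincomb1[OF arg_cong[OF T2b, of T], of _ _ 1, unfolded T_simps]) algebra
  have T4b: "T (T (T (T b))) = T (T (T (T (T c)))) + x * q ^ 10 * T (T (T (T (T b))))"
    by (rule lincomb1[OF arg_cong[OF T3b, of T], of _ _ 1, unfolded T_simps]) algebra
  have "s = x ^ 2 * q ^ 6 * T (T b) - x * (q ^ 2 + q ^ 3) * x ^ 2 * q ^ 10 * T (T (T b))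
    - x * q ^ 3 * (1 - x * q ^ 4) * x ^ 2 * q ^ 14 * T (T (T (T b)))"
    unfolding s_def by (rule lincomb1[OF g_c[unfolded g T_simps], of _ _ 1]) algebra
  \<comment> \<open>Replacing \<open>T^2 b\<close>, then \<open>T^3 b\<close>, cancels terms so that
    \<open>b\<close> survives in one monomial.\<close>
  then have s: "s = x ^ 2 * q ^ 6 * T (T (T c)) - x ^ 3 * q ^ 13 * T (T (T (T c)))
      - x ^ 3 * q ^ 17 * T (T (T (T b)))"
    by (rule lincomb3[OF _ T2b T3b, of _ _ _ _ 1 "x ^ 2 * q ^ 6" "- (x ^ 3 * q ^ 13)"]) algebra
  \<comment> \<open>Here \<open>x^3\<close> gains \<open>q^6\<close>, so \<open>x q^4\<close>
    produces the \<open>x q^10\<close> of \<open>T4b\<close>.\<close>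
  have "s - x * q ^ 4 * T s = x ^ 2 * q ^ 6 * T (T (T c)) - x ^ 3 * (q ^ 13 + q ^ 14) * T (T (T (T c)))
      - x ^ 3 * q ^ 17 * (1 - x * q ^ 6) * T (T (T (T (T c))))"
    by (rule lincomb3[OF s arg_cong[OF s, of T] T4b, of _ _ 1 "- (x * q ^ 4)" "- (x ^ 3 * q ^ 17)",
          unfolded T_simps]) algebra
  then show ?thesis
    unfolding s_def k_def T_simps by (rule lincomb1[where ?k1.0 = "-1"]) algebra
qed

lemma equation_b:
  "0 = b + (- 1 - x * (q^2 + q^4 + q^5)) * T b + x * q^4 * (1 + x * q^5 + x * q^7) * T (T b) +
     x^2 * q^10 * (- 1 + x * q^4 + x * q^6) * T (T (T b)) +
     x^3 * q^18 * (1 + q + q^3) * (1 - x * q^6) * T (T (T (T b))) +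
     x^3 * q^23 * (1 - x * q^6) * (1 - x * q^8) * T (T (T (T (T b))))"
proof -
  \<comment> \<open>\<open>T_c\<close> expresses \<open>T c\<close> but not \<open>c\<close> through
    \<open>b\<close>, so \<open>c_g\<close> and \<open>g_c\<close> are used after one application of
    \<open>T\<close>.\<close>
  have Tg: "T g = b - x * q ^ 2 * T b - x ^ 2 * q ^ 8 * T (T b)
      - x ^ 2 * q ^ 10 * (1 - x * q ^ 4) * T (T (T b))"
    by (rule lincomb1[OF arg_cong[OF c_g, of T, unfolded T_simps T_c], of _ _ "-1"]) algebra
  show ?thesis
    by (rule lincomb1[OF arg_cong[OF g_c, of T, unfolded T_simps T_c Tg], of _ _ "-1"]) algebra
qed

end

section \<open>The system satisfied by the series of the states\<close>

lemma gf_far_eq: "v \<le> -4 \<Longrightarrow> (f, v) \<noteq> (Free, -4) \<Longrightarrow> gf f v = gf Free (-4)"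
  by (rule gf_far) simp_all

lemma gf_2:
  "gf Repeat 2 = qshift 2 (gf Repeat 0)" "gf Chain 2 = qshift 2 (gf Chain 0)"
  "gf Near 2 = qshift 2 (gf Near 0)"
  "gf Four 2 = qshift 2 (gf Four 0) + varx * varq ^ 2 * gf Repeat 2"
  "gf Free 2 = qshift 2 (gf Free 0) + varx * varq ^ 2 * gf Repeat 2"
  by (simp_all add: gf_rec[of 2] Let_def)

lemma gf_1:
  "gf Repeat 1 = qshift 2 (gf Repeat (-1))" "gf Near 1 = qshift 2 (gf Near (-1))"
  "gf Four 1 = qshift 2 (gf Four (-1))"
  "gf Free 1 = qshift 2 (gf Free (-1)) + varx * varq * gf Repeat 1"
  by (simp_all add: gf_rec[of 1] Let_def)

lemma gf_0:
  "gf Repeat 0 = qshift 2 (gf Repeat (-2))"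
  "gf Chain 0 = qshift 2 (gf Chain (-2)) + varx * varq ^ 2 * gf Chain 2"
  "gf Near 0 = qshift 2 (gf Near (-2)) + varx * varq ^ 2 * gf Near 2"
  "gf Four 0 = qshift 2 (gf Four (-2)) + varx * varq ^ 2 * gf Near 2"
  "gf Free 0 = qshift 2 (gf Free (-2)) + varx * varq ^ 2 * gf Near 2"
  by (simp_all add: gf_rec[of 0] Let_def)

lemma gf_minus1:
  "gf Repeat (-1) = qshift 2 (gf Repeat (-3)) + varx * varq ^ 2 * gf Chain 2"
  "gf Near (-1) = qshift 2 (gf Near (-3)) + varx * varq * gf Near 1 + varx * varq ^ 2 * gf Near 2"
  "gf Four (-1) = qshift 2 (gf Four (-3)) + varx * varq * gf Near 1 + varx * varq ^ 2 * gf Near 2"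
  "gf Free (-1) = qshift 2 (gf Free (-3)) + varx * varq * gf Near 1 + varx * varq ^ 2 * gf Near 2"
  by (simp_all add: gf_rec[of "-1"] Let_def)

lemma gf_minus2:
  "gf Repeat (-2) = qshift 2 (gf Free (-4)) + varx * varq ^ 2 * gf Four 2"
  "gf Chain (-2) = qshift 2 (gf Free (-4)) + varx * varq ^ 2 * gf Four 2"
  "gf Near (-2) = qshift 2 (gf Free (-4)) + varx * varq * gf Near 1 + varx * varq ^ 2 * gf Four 2"
  "gf Four (-2) = qshift 2 (gf Free (-4)) + varx * varq * gf Near 1 + varx * varq ^ 2 * gf Four 2"
  "gf Free (-2) = qshift 2 (gf Free (-4)) + varx * varq * gf Near 1 + varx * varq ^ 2 * gf Four 2"
  by (simp_all add: gf_rec[of "-2"] gf_far_eq Let_def)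

lemma gf_minus3:
  "gf Repeat (-3) = qshift 2 (gf Free (-4)) + varx * varq ^ 2 * gf Free 2"
  "gf Near (-3) = qshift 2 (gf Free (-4)) + varx * varq * gf Four 1 + varx * varq ^ 2 * gf Free 2"
  "gf Four (-3) = qshift 2 (gf Free (-4)) + varx * varq * gf Four 1 + varx * varq ^ 2 * gf Free 2"
  "gf Free (-3) = qshift 2 (gf Free (-4)) + varx * varq * gf Four 1 + varx * varq ^ 2 * gf Free 2"
  by (simp_all add: gf_rec[of "-3"] gf_far_eq Let_def)

lemma gf_minus4:
  "gf Free (-4) = qshift 2 (gf Free (-4)) + varx * varq * gf Free 1 + varx * varq ^ 2 * gf Free 2"
  by (subst gf_rec) (simp_all add: gf_far_eq Let_def)

text \<open>
  States with equal right-hand sides in the recursions have equal series; resolving them in the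
  order below leaves the six unknowns of the system.
\<close>

lemma gf_merge:
  "gf Four (-2) = gf Near (-2)" "gf Free (-2) = gf Near (-2)" "gf Repeat (-2) = gf Chain (-2)"
  "gf Near 0 = gf Four 0" "gf Free 0 = gf Four 0"
  "gf Near (-1) = gf Free (-1)" "gf Four (-1) = gf Free (-1)"
  "gf Free 2 = gf Four 2" "gf Near 1 = gf Four 1"
  "gf Repeat (-3) = gf Chain (-2)" "gf Free (-3) = gf Near (-2)"
  "gf Repeat (-1) = gf Chain 0"
proof -
  show 1: "gf Four (-2) = gf Near (-2)" "gf Free (-2) = gf Near (-2)" "gf Repeat (-2) = gf Chain (-2)"
    by (simp_all only: gf_minus2)
  then show 2: "gf Near 0 = gf Four 0" "gf Free 0 = gf Four 0" by (simp_all only: gf_0)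
  show 3: "gf Near (-1) = gf Free (-1)" "gf Four (-1) = gf Free (-1)" by (simp_all only: gf_minus1 gf_minus3)
  show 4: "gf Free 2 = gf Four 2" by (simp only: gf_2 2)
  show 5: "gf Near 1 = gf Four 1" by (simp only: gf_1 3)
  show 6: "gf Repeat (-3) = gf Chain (-2)" by (simp only: gf_minus3 gf_minus2 4)
  show "gf Free (-3) = gf Near (-2)" by (simp only: gf_minus3 gf_minus2 4 5)
  show "gf Repeat (-1) = gf Chain 0" by (simp only: gf_minus1 gf_0 6)
qed

lemma q_difference_system_gf:
  "q_difference_system (qshift 2) varx varq
     (gf Free (-1)) (gf Chain 0) (gf Chain (-2)) (gf Free (-4)) (gf Four 0) (gf Near (-2))"
proof
  fix u v
  show "qshift 2 (u + v) = qshift 2 u + qshift 2 v" by (rule qshift_add)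
  show "qshift 2 (u * v) = qshift 2 u * qshift 2 v" by (rule qshift_mult)
  show "qshift 2 1 = 1" using qshift_varq_power[of 2 0] by simp
  show "qshift 2 varx = varx * varq ^ 2" by (rule qshift_varx)
  show "qshift 2 varq = varq" using qshift_varq_power[of 2 1] by simp
  show "gf Chain 0 = qshift 2 (gf Chain (-2)) + varx * varq ^ 2 * qshift 2 (gf Chain 0)"
    using gf_0(2) by (simp only: gf_2)
  show g: "gf Four 0 = qshift 2 (gf Near (-2)) + varx * varq ^ 2 * qshift 2 (gf Four 0)"
    using gf_0(4) by (simp only: gf_2 gf_merge)
  have far: "gf Near (-2) = qshift 2 (gf Free (-4)) + varx * varq * qshift 2 (gf Free (-1)) +
      varx * varq ^ 2 * gf Four 2"
    using gf_minus2(3) by (simp only: gf_1 gf_merge)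
  show "gf Free (-1) = gf Four 0 + varx * varq * qshift 2 (gf Free (-1))"
    using gf_minus1(4) by (subst g) (simp only: gf_1 gf_2 gf_merge ac_simps)
  show "gf Near (-2) = gf Chain (-2) + varx * varq * qshift 2 (gf Free (-1))"
    unfolding far gf_minus2(2) by (simp only: ac_simps)
  \<comment> \<open>The extra term counts the partitions with two parts 1.\<close>
  show "gf Free (-4) = gf Near (-2) + (varx * varq) ^ 2 * qshift 2 (gf Chain 0)"
    using gf_minus4 unfolding far by (simp add: gf_1 gf_merge algebra_simps power2_eq_square)
  \<comment> \<open>The last term comes from two parts 2: \<open>Repeat\<close> at 2 is translated
    to 0 and to -2, where it has the series of \<open>Chain\<close>.\<close>
  show "gf Chain (-2) = qshift 2 (gf Free (-4)) + varx * varq ^ 2 * qshift 2 (gf Four 0) +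
      (varx * varq ^ 2) ^ 2 * qshift 2 (qshift 2 (gf Chain (-2)))"
    using gf_minus2(2) by (simp add: gf_2 gf_0(1) gf_merge algebra_simps power2_eq_square)
qed

lemma sum_0_5: "(\<Sum>i=0..5. f i) = f 0 + f 1 + f 2 + f 3 + f 4 + f (5::nat)" for f :: "nat \<Rightarrow> series"
  by (simp add: eval_nat_numeral)

theorem proposition4p2:
  "0 = (\<Sum>i=0..5. coeffs1 varx varq ! i * qshift (2 * i) (gen_series setN1)) \<and>
   0 = (\<Sum>i=0..5. coeffs2 varx varq ! i * qshift (2 * i) (gen_series setN2)) \<and>
   0 = (\<Sum>i=0..5. coeffs3 varx varq ! i * qshift (2 * i) (gen_series setN3))"
proof -
  interpret q_difference_system "qshift 2" varx varq
    "gf Free (-1)" "gf Chain 0" "gf Chain (-2)" "gf Free (-4)" "gf Four 0" "gf Near (-2)"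
    by (rule q_difference_system_gf)
  have "0 = (\<Sum>i=0..5. coeffs1 varx varq ! i * qshift (2 * i) (gf Chain (-2)))"
    using equation_c by (simp add: sum_0_5 coeffs1_def qshift_qshift qshift_0)
  moreover have "0 = (\<Sum>i=0..5. coeffs2 varx varq ! i * qshift (2 * i) (gf Free (-1)))"
    using equation_a by (simp add: sum_0_5 coeffs2_def qshift_qshift qshift_0)
  moreover have "0 = (\<Sum>i=0..5. coeffs3 varx varq ! i * qshift (2 * i) (gf Chain 0))"
    using equation_b by (simp add: sum_0_5 coeffs3_def qshift_qshift qshift_0)
  ultimately show ?thesis
    unfolding setN1_eq setN2_eq setN3_eq gf_def by blast
qed

end
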